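(* Let $\sigma:M\to N$ be a prefibration of monoids, $A=\mathrm{Ker}(\sigma)$, and let $\kappa$ be a cleavage of $\sigma$. Let $\phi:A\times N\to A$ and $\gamma:N\times N\to A$ be the functions uniquely determined by $$a\kappa(n)=\kappa(n)\phi_n(a),\qquad \kappa(m)\kappa(n)=\kappa(mn)\gamma_{m,n}\qquad(a\in A,\ m,n\in N).$$ Then $(\phi,\gamma)$ is a lax action of $N$ on $A$. If $\sigma$ is a fibration, then it is a pseudo action of $N$ on $A$.
   Context: For a monoid homomorphism $\sigma:M\to N$ with $\mathrm{Ker}(\sigma)=\sigma^{-1}(1)$, an element $x\in M$ is $\sigma$-precartesian if for every $z\in M$ with $\sigma(z)=\sigma(x)$ there is a unique $y\in\mathrm{Ker}(\sigma)$ with $z=xy$. It is $\sigma$-cartesian if (i) for every $z\in M$, $v\in N$ with $\sigma(z)=\sigma(x)v$ there is $y\in M$ with $z=xy$, $\sigma(y)=v$; and (ii) $xy_1=xy_2$ and $\sigma(y_1)=\sigma(y_2)$ imply $y_1=y_2$. $\sigma$ is a prefibration (resp. fibration) if above every element of $N$ there is a $\sigma$-precartesian (resp. $\sigma$-cartesian) element. A cleavage of a prefibration $\sigma$ is a map $\kappa:N\to M$ with $\kappa(1)=1$ such that each $\kappa(n)$ is $\sigma$-precartesian with $\sigma(\kappa(n))=n$. Since $\kappa(n)$ (resp. $\kappa(mn)$) is precartesian, the elements $\phi_n(a)$ and $\gamma_{m,n}$ of $A$ exist and are unique. A lax action of a monoid $N$ on a monoid $A$ is given by maps $\phi:A\times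 N\to A$, $(a,n)\mapsto\phi_n(a)$, and $\gamma:N\times N\to A$ such that for all $a,b\in A$ and $m,n,k\in N$: (i) $\phi_1(a)=a$; (ii) $\gamma_{m,n}\phi_n(\phi_m(a))=\phi_{mn}(a)\gamma_{m,n}$; (iii) $\gamma_{mn,k}\phi_k(\gamma_{m,n})=\gamma_{m,nk}\gamma_{n,k}$; (iv) $\gamma_{1,m}=1=\gamma_{m,1}$; (v) $\phi_m(1)=1$ and $\phi_m(ab)=\phi_m(a)\phi_m(b)$. It is a pseudo action if every $\gamma_{m,n}$ is invertible in $A$. *)

theory Defs
  imports "HOL-Algebra.Coset"
begin

text \<open>For monoids (unlike groups) \<^term>\<open>\<sigma> \<in> hom M N\<close> does not imply that the identity is preserved.\<close>

definition monoid_homomorphism ::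
  "('a, 'x) monoid_scheme \<Rightarrow> ('b, 'y) monoid_scheme \<Rightarrow> ('a \<Rightarrow> 'b) \<Rightarrow> bool"
where
  "monoid_homomorphism M N \<sigma> \<longleftrightarrow>
     monoid M \<and> monoid N \<and> \<sigma> \<in> hom M N \<and> \<sigma> \<one>\<^bsub>M\<^esub> = \<one>\<^bsub>N\<^esub>"

definition kernel_monoid ::
  "('a, 'x) monoid_scheme \<Rightarrow> ('b, 'y) monoid_scheme \<Rightarrow> ('a \<Rightarrow> 'b) \<Rightarrow> ('a, 'x) monoid_scheme"
where
  "kernel_monoid M N \<sigma> = M\<lparr>carrier := kernel M N \<sigma>\<rparr>"

definition precartesian ::
  "('a, 'x) monoid_scheme \<Rightarrow> ('b, 'y) monoid_scheme \<Rightarrow> ('a \<Rightarrow> 'b) \<Rightarrow> 'a \<Rightarrow> bool"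
where
  "precartesian M N \<sigma> x \<longleftrightarrow>
     x \<in> carrier M \<and>
     (\<forall>z \<in> carrier M. \<sigma> z = \<sigma> x \<longrightarrow> (\<exists>!y. y \<in> kernel M N \<sigma> \<and> z = x \<otimes>\<^bsub>M\<^esub> y))"

definition cartesian ::
  "('a, 'x) monoid_scheme \<Rightarrow> ('b, 'y) monoid_scheme \<Rightarrow> ('a \<Rightarrow> 'b) \<Rightarrow> 'a \<Rightarrow> bool"
where
  "cartesian M N \<sigma> x \<longleftrightarrow>
     x \<in> carrier M \<and>
     (\<forall>z \<in> carrier M. \<forall>v \<in> carrier N. \<sigma> z = \<sigma> x \<otimes>\<^bsub>N\<^esub> v \<longrightarrow>
        (\<exists>y \<in> carrier M. z = x \<otimes>\<^bsub>M\<^esub> y \<and> \<sigma> y = v)) \<and>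
     (\<forall>y\<^sub>1 \<in> carrier M. \<forall>y\<^sub>2 \<in> carrier M.
        x \<otimes>\<^bsub>M\<^esub> y\<^sub>1 = x \<otimes>\<^bsub>M\<^esub> y\<^sub>2 \<and> \<sigma> y\<^sub>1 = \<sigma> y\<^sub>2 \<longrightarrow> y\<^sub>1 = y\<^sub>2)"

definition prefibration ::
  "('a, 'x) monoid_scheme \<Rightarrow> ('b, 'y) monoid_scheme \<Rightarrow> ('a \<Rightarrow> 'b) \<Rightarrow> bool"
where
  "prefibration M N \<sigma> \<longleftrightarrow>
     monoid_homomorphism M N \<sigma> \<and>
     (\<forall>n \<in> carrier N. \<exists>x \<in> carrier M. \<sigma> x = n \<and> precartesian M N \<sigma> x)"

definition fibration ::
  "('a, 'x) monoid_scheme \<Rightarrow> ('b, 'y) monoid_scheme \<Rightarrow> ('a \<Rightarrow> 'b) \<Rightarrow> bool"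
where
  "fibration M N \<sigma> \<longleftrightarrow>
     monoid_homomorphism M N \<sigma> \<and>
     (\<forall>n \<in> carrier N. \<exists>x \<in> carrier M. \<sigma> x = n \<and> cartesian M N \<sigma> x)"

definition cleavage ::
  "('a, 'x) monoid_scheme \<Rightarrow> ('b, 'y) monoid_scheme \<Rightarrow> ('a \<Rightarrow> 'b) \<Rightarrow> ('b \<Rightarrow> 'a) \<Rightarrow> bool"
where
  "cleavage M N \<sigma> \<kappa> \<longleftrightarrow>
     \<kappa> \<in> carrier N \<rightarrow> carrier M \<and> \<kappa> \<one>\<^bsub>N\<^esub> = \<one>\<^bsub>M\<^esub> \<and>
     (\<forall>n \<in> carrier N. precartesian M N \<sigma> (\<kappa> n) \<and> \<sigma> (\<kappa> n) = n)"

text \<open>\<^term>\<open>\<phi> n a\<close> and \<^term>\<open>\<gamma> m n\<close> stand for $\phi_n(a)$ and $\gamma_{m,n}$; the values of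
  the functions outside the carriers are irrelevant.\<close>

definition lax_action ::
  "('b, 'y) monoid_scheme \<Rightarrow> ('a, 'x) monoid_scheme \<Rightarrow>
   ('b \<Rightarrow> 'a \<Rightarrow> 'a) \<Rightarrow> ('b \<Rightarrow> 'b \<Rightarrow> 'a) \<Rightarrow> bool"
where
  "lax_action N A \<phi> \<gamma> \<longleftrightarrow>
     monoid N \<and> monoid A \<and>
     \<phi> \<in> carrier N \<rightarrow> carrier A \<rightarrow> carrier A \<and>
     \<gamma> \<in> carrier N \<rightarrow> carrier N \<rightarrow> carrier A \<and>
     (\<forall>a \<in> carrier A. \<phi> \<one>\<^bsub>N\<^esub> a = a) \<and>
     (\<forall>a \<in> carrier A. \<forall>m \<in> carrier N. \<forall>n \<in> carrier N.
        \<gamma> m n \<otimes>\<^bsub>A\<^esub> \<phi> n (\<phi> m a) = \<phi> (m \<otimes>\<^bsub>N\<^esub> n) a \<otimes>\<^bsub>A\<^esub> \<gamma> m n) \<and>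
     (\<forall>m \<in> carrier N. \<forall>n \<in> carrier N. \<forall>k \<in> carrier N.
        \<gamma> (m \<otimes>\<^bsub>N\<^esub> n) k \<otimes>\<^bsub>A\<^esub> \<phi> k (\<gamma> m n) = \<gamma> m (n \<otimes>\<^bsub>N\<^esub> k) \<otimes>\<^bsub>A\<^esub> \<gamma> n k) \<and>
     (\<forall>m \<in> carrier N. \<gamma> \<one>\<^bsub>N\<^esub> m = \<one>\<^bsub>A\<^esub> \<and> \<gamma> m \<one>\<^bsub>N\<^esub> = \<one>\<^bsub>A\<^esub>) \<and>
     (\<forall>m \<in> carrier N. \<phi> m \<one>\<^bsub>A\<^esub> = \<one>\<^bsub>A\<^esub>) \<and>
     (\<forall>m \<in> carrier N. \<forall>a \<in> carrier A. \<forall>b \<in> carrier A.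
        \<phi> m (a \<otimes>\<^bsub>A\<^esub> b) = \<phi> m a \<otimes>\<^bsub>A\<^esub> \<phi> m b)"

definition pseudo_action ::
  "('b, 'y) monoid_scheme \<Rightarrow> ('a, 'x) monoid_scheme \<Rightarrow>
   ('b \<Rightarrow> 'a \<Rightarrow> 'a) \<Rightarrow> ('b \<Rightarrow> 'b \<Rightarrow> 'a) \<Rightarrow> bool"
where
  "pseudo_action N A \<phi> \<gamma> \<longleftrightarrow>
     lax_action N A \<phi> \<gamma> \<and> (\<forall>m \<in> carrier N. \<forall>n \<in> carrier N. \<gamma> m n \<in> Units A)"

definition determined_by_cleavage ::
  "('a, 'x) monoid_scheme \<Rightarrow> ('b, 'y) monoid_scheme \<Rightarrow> ('a \<Rightarrow> 'b) \<Rightarrow> ('b \<Rightarrow> 'a) \<Rightarrow>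
   ('b \<Rightarrow> 'a \<Rightarrow> 'a) \<Rightarrow> ('b \<Rightarrow> 'b \<Rightarrow> 'a) \<Rightarrow> bool"
where
  "determined_by_cleavage M N \<sigma> \<kappa> \<phi> \<gamma> \<longleftrightarrow>
     (\<forall>a \<in> kernel M N \<sigma>. \<forall>n \<in> carrier N.
        \<phi> n a \<in> kernel M N \<sigma> \<and> a \<otimes>\<^bsub>M\<^esub> \<kappa> n = \<kappa> n \<otimes>\<^bsub>M\<^esub> \<phi> n a) \<and>
     (\<forall>m \<in> carrier N. \<forall>n \<in> carrier N.
        \<gamma> m n \<in> kernel M N \<sigma> \<and> \<kappa> m \<otimes>\<^bsub>M\<^esub> \<kappa> n = \<kappa> (m \<otimes>\<^bsub>N\<^esub> n) \<otimes>\<^bsub>M\<^esub> \<gamma> m n)"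

end

theory Submission
  imports Defs
begin

text \<open>
  A precartesian element is left cancellable on the kernel, so an equation in the kernel may be
  checked after multiplying both sides on the left by a suitable \<open>\<kappa> n\<close>. The laws of a lax
  action then come from associativity in \<open>M\<close>: the two sides of the interchange law between \<open>\<phi>\<close>
  and \<open>\<gamma>\<close> both rewrite to \<open>a \<kappa>(m) \<kappa>(n)\<close>, and the two sides of the cocycle law both rewrite to
  \<open>\<kappa>(m) \<kappa>(n) \<kappa>(k)\<close>.

  For the pseudo action, the point is that \<open>\<gamma> m n\<close> compares two elements above \<open>m n\<close>, namely
  \<open>\<kappa>(m) \<kappa>(n)\<close> and \<open>\<kappa>(m n)\<close>. Precartesian elements with the same image differ by a unit of the
  kernel (\<open>precartesian_unique_up_to_unit\<close>), so it suffices that \<open>\<kappa>(m) \<kappa>(n)\<close> is precartesian.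
  Precartesian elements need not be closed under products, but cartesian ones are
  (\<open>cartesian_mult\<close>), and in a fibration the two notions agree
  (\<open>fibration_precartesian_imp_cartesian\<close>): a precartesian element is a cartesian one times a unit.
\<close>

section \<open>Cartesian and precartesian elements\<close>

locale monoid_morphism = M: monoid M + N: monoid N
  for M :: "('a, 'x) monoid_scheme" and N :: "('b, 'y) monoid_scheme" +
  fixes \<sigma> :: "'a \<Rightarrow> 'b"
  assumes hom: "\<sigma> \<in> hom M N"
    and map_one: "\<sigma> \<one>\<^bsub>M\<^esub> = \<one>\<^bsub>N\<^esub>"
begin

abbreviation A :: "('a, 'x) monoid_scheme" where "A \<equiv> kernel_monoid M N \<sigma>"
abbreviation K :: "'a set" where "K \<equiv> kernel M N \<sigma>"

lemma map_closed: "x \<in> carrier M \<Longrightarrow> \<sigma> x \<in> carrier N"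
  using hom by (rule hom_in_carrier)

lemma map_mult:
  "\<lbrakk>x \<in> carrier M; y \<in> carrier M\<rbrakk> \<Longrightarrow> \<sigma> (x \<otimes>\<^bsub>M\<^esub> y) = \<sigma> x \<otimes>\<^bsub>N\<^esub> \<sigma> y"
  using hom by (rule hom_mult)

lemma kernel_closed: "a \<in> K \<Longrightarrow> a \<in> carrier M"
  by (simp add: kernel_def)

lemma kernel_map: "a \<in> K \<Longrightarrow> \<sigma> a = \<one>\<^bsub>N\<^esub>"
  by (simp add: kernel_def)

lemma kernel_one: "\<one>\<^bsub>M\<^esub> \<in> K"
  by (simp add: kernel_def map_one)

lemma kernel_mult: "\<lbrakk>a \<in> K; b \<in> K\<rbrakk> \<Longrightarrow> a \<otimes>\<^bsub>M\<^esub> b \<in> K"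
  by (simp add: kernel_def map_mult)

lemma kernel_monoid_simps:
  "carrier A = K" "mult A = mult M" "one A = one M"
  by (simp_all add: kernel_monoid_def)

lemma monoid_kernel: "monoid A"
  by (rule monoidI)
     (auto simp: kernel_monoid_simps intro: kernel_one kernel_mult M.m_assoc M.l_one M.r_one kernel_closed)

lemma precartesian_cancel:
  assumes x: "precartesian M N \<sigma> x" and a: "a \<in> K" and b: "b \<in> K"
    and eq: "x \<otimes>\<^bsub>M\<^esub> a = x \<otimes>\<^bsub>M\<^esub> b"
  shows "a = b"
proof -
  have xM: "x \<in> carrier M"
    using x by (simp add: precartesian_def)
  have "\<sigma> (x \<otimes>\<^bsub>M\<^esub> a) = \<sigma> x" "x \<otimes>\<^bsub>M\<^esub> a \<in> carrier M"
    using xM a by (simp_all add: map_mult kernel_closed kernel_map map_closed)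
  then have "\<exists>!y. y \<in> K \<and> x \<otimes>\<^bsub>M\<^esub> a = x \<otimes>\<^bsub>M\<^esub> y"
    using x unfolding precartesian_def by blast
  then show ?thesis
    using a b eq by blast
qed

lemma precartesian_factor:
  assumes "precartesian M N \<sigma> x" "z \<in> carrier M" "\<sigma> z = \<sigma> x"
  obtains a where "a \<in> K" "z = x \<otimes>\<^bsub>M\<^esub> a"
  using assms unfolding precartesian_def by blast

text \<open>Each element factors through the other, and cancelling either of them shows that the two
  factors are mutually inverse.\<close>

lemma precartesian_unique_up_to_unit:
  assumes x: "precartesian M N \<sigma> x" and y: "precartesian M N \<sigma> y"
    and a: "a \<in> K" and y_eq: "y = x \<otimes>\<^bsub>M\<^esub> a"
  shows "a \<in> Units A"
proof -
  have xM: "x \<in> carrier M" and yM: "y \<in> carrier M"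
    using x y by (simp_all add: precartesian_def)
  have "\<sigma> x = \<sigma> y"
    using xM a by (simp add: y_eq map_mult kernel_closed kernel_map map_closed)
  then obtain b where b: "b \<in> K" and x_eq: "x = y \<otimes>\<^bsub>M\<^esub> b"
    using precartesian_factor[OF y xM] by blast
  have "x \<otimes>\<^bsub>M\<^esub> (a \<otimes>\<^bsub>M\<^esub> b) = x \<otimes>\<^bsub>M\<^esub> \<one>\<^bsub>M\<^esub>"
    using xM a b by (simp add: M.m_assoc[symmetric] kernel_closed flip: x_eq y_eq)
  then have ab: "a \<otimes>\<^bsub>M\<^esub> b = \<one>\<^bsub>M\<^esub>"
    using precartesian_cancel[OF x] a b kernel_mult kernel_one by blast
  have "y \<otimes>\<^bsub>M\<^esub> (b \<otimes>\<^bsub>M\<^esub> a) = y \<otimes>\<^bsub>M\<^esub> \<one>\<^bsub>M\<^esub>"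
    using yM a b by (simp add: M.m_assoc[symmetric] kernel_closed flip: x_eq y_eq)
  then have ba: "b \<otimes>\<^bsub>M\<^esub> a = \<one>\<^bsub>M\<^esub>"
    using precartesian_cancel[OF y] a b kernel_mult kernel_one by blast
  show ?thesis
    using a b ab ba by (auto simp: Units_def kernel_monoid_simps)
qed

text \<open>This is the case \<open>v = 1\<close> of both clauses of the definition.\<close>

lemma cartesian_imp_precartesian:
  assumes x: "cartesian M N \<sigma> x"
  shows "precartesian M N \<sigma> x"
  unfolding precartesian_def
proof (intro conjI ballI impI)
  show xM: "x \<in> carrier M"
    using x by (simp add: cartesian_def)
  fix z assume z: "z \<in> carrier M" and "\<sigma> z = \<sigma> x"
  then have "\<sigma> z = \<sigma> x \<otimes>\<^bsub>N\<^esub> \<one>\<^bsub>N\<^esub>"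
    using xM by (simp add: map_closed)
  then obtain y where y: "y \<in> K" "z = x \<otimes>\<^bsub>M\<^esub> y"
    using x z unfolding cartesian_def kernel_def by blast
  show "\<exists>!y. y \<in> K \<and> z = x \<otimes>\<^bsub>M\<^esub> y"
  proof (rule ex1I[of _ y])
    show "y \<in> K \<and> z = x \<otimes>\<^bsub>M\<^esub> y"
      using y by simp
    fix y' assume "y' \<in> K \<and> z = x \<otimes>\<^bsub>M\<^esub> y'"
    then show "y' = y"
      using x y kernel_closed[of y] kernel_closed[of y'] kernel_map[of y] kernel_map[of y']
      unfolding cartesian_def by metis
  qed
qed

text \<open>To factor an element through a product, factor it through the left factor and then factor
  the quotient through the right one. The quotient lies above \<open>\<sigma> y\<close> times the prescribed element
  rather than above \<open>\<sigma> y\<close>, which is why the argument fails for precartesian elements.\<close>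

lemma cartesian_mult:
  assumes x: "cartesian M N \<sigma> x" and y: "cartesian M N \<sigma> y"
  shows "cartesian M N \<sigma> (x \<otimes>\<^bsub>M\<^esub> y)"
proof -
  have xM: "x \<in> carrier M" and yM: "y \<in> carrier M"
    using x y by (simp_all add: cartesian_def)
  show ?thesis
    unfolding cartesian_def
  proof (intro conjI ballI impI)
    show "x \<otimes>\<^bsub>M\<^esub> y \<in> carrier M"
      using xM yM by simp
  next
    fix z v assume z: "z \<in> carrier M" and v: "v \<in> carrier N"
      and "\<sigma> z = \<sigma> (x \<otimes>\<^bsub>M\<^esub> y) \<otimes>\<^bsub>N\<^esub> v"
    then have "\<sigma> z = \<sigma> x \<otimes>\<^bsub>N\<^esub> (\<sigma> y \<otimes>\<^bsub>N\<^esub> v)"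
      using xM yM by (simp add: map_mult map_closed N.m_assoc)
    moreover have "\<sigma> y \<otimes>\<^bsub>N\<^esub> v \<in> carrier N"
      using yM v by (simp add: map_closed)
    ultimately obtain w where w: "w \<in> carrier M" "z = x \<otimes>\<^bsub>M\<^esub> w" "\<sigma> w = \<sigma> y \<otimes>\<^bsub>N\<^esub> v"
      using x z unfolding cartesian_def by blast
    then obtain u where u: "u \<in> carrier M" "w = y \<otimes>\<^bsub>M\<^esub> u" "\<sigma> u = v"
      using y v unfolding cartesian_def by blast
    have "z = x \<otimes>\<^bsub>M\<^esub> y \<otimes>\<^bsub>M\<^esub> u"
      using xM yM w u by (simp add: M.m_assoc)
    then show "\<exists>u \<in> carrier M. z = x \<otimes>\<^bsub>M\<^esub> y \<otimes>\<^bsub>M\<^esub> u \<and> \<sigma> u = v"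
      using u by blast
  next
    fix u v assume u: "u \<in> carrier M" and v: "v \<in> carrier M"
      and eq: "x \<otimes>\<^bsub>M\<^esub> y \<otimes>\<^bsub>M\<^esub> u = x \<otimes>\<^bsub>M\<^esub> y \<otimes>\<^bsub>M\<^esub> v \<and> \<sigma> u = \<sigma> v"
    then have "x \<otimes>\<^bsub>M\<^esub> (y \<otimes>\<^bsub>M\<^esub> u) = x \<otimes>\<^bsub>M\<^esub> (y \<otimes>\<^bsub>M\<^esub> v)" "\<sigma> (y \<otimes>\<^bsub>M\<^esub> u) = \<sigma> (y \<otimes>\<^bsub>M\<^esub> v)"
      using xM yM by (simp_all add: M.m_assoc map_mult)
    then have "y \<otimes>\<^bsub>M\<^esub> u = y \<otimes>\<^bsub>M\<^esub> v"
      using x u v M.m_closed[OF yM] unfolding cartesian_def by blast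
    then show "u = v"
      using y u v eq unfolding cartesian_def by blast
  qed
qed

lemma cartesian_unit:
  assumes u: "u \<in> Units M"
  shows "cartesian M N \<sigma> u"
proof -
  obtain w where uM: "u \<in> carrier M" and w: "w \<in> carrier M"
    and uw: "u \<otimes>\<^bsub>M\<^esub> w = \<one>\<^bsub>M\<^esub>" and wu: "w \<otimes>\<^bsub>M\<^esub> u = \<one>\<^bsub>M\<^esub>"
    using u unfolding Units_def by blast
  show ?thesis
    unfolding cartesian_def
  proof (intro conjI ballI impI)
    show "u \<in> carrier M" by fact
  next
    fix z v assume z: "z \<in> carrier M" and v: "v \<in> carrier N" and eq: "\<sigma> z = \<sigma> u \<otimes>\<^bsub>N\<^esub> v"
    have "\<sigma> w \<otimes>\<^bsub>N\<^esub> \<sigma> u = \<one>\<^bsub>N\<^esub>"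
      using map_mult[OF w uM] by (simp add: wu map_one)
    then have "\<sigma> (w \<otimes>\<^bsub>M\<^esub> z) = v"
      using z v w uM by (simp add: map_mult eq map_closed N.m_assoc[symmetric])
    moreover have "z = u \<otimes>\<^bsub>M\<^esub> (w \<otimes>\<^bsub>M\<^esub> z)"
      using z w uM uw by (simp add: M.m_assoc[symmetric])
    ultimately show "\<exists>y \<in> carrier M. z = u \<otimes>\<^bsub>M\<^esub> y \<and> \<sigma> y = v"
      using z w by blast
  next
    fix y z assume "y \<in> carrier M" "z \<in> carrier M" "u \<otimes>\<^bsub>M\<^esub> y = u \<otimes>\<^bsub>M\<^esub> z \<and> \<sigma> y = \<sigma> z"
    then show "y = z"
      using u by simp
  qed
qed

text \<open>The fibration provides some cartesian \<open>c\<close> above \<open>\<sigma> x\<close>. It is precartesian too, so \<open>x\<close> is \<open>c\<close>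
  times a unit of the kernel, a product of two cartesian elements.\<close>

lemma fibration_precartesian_imp_cartesian:
  assumes fib: "fibration M N \<sigma>" and x: "precartesian M N \<sigma> x"
  shows "cartesian M N \<sigma> x"
proof -
  have xM: "x \<in> carrier M"
    using x by (simp add: precartesian_def)
  then obtain c where c: "cartesian M N \<sigma> c" and "\<sigma> c = \<sigma> x"
    using fib map_closed unfolding fibration_def by blast
  then have c_pre: "precartesian M N \<sigma> c"
    by (simp add: cartesian_imp_precartesian)
  obtain u where u: "u \<in> K" and x_eq: "x = c \<otimes>\<^bsub>M\<^esub> u"
    using precartesian_factor[OF c_pre xM] \<open>\<sigma> c = \<sigma> x\<close> by metis
  have "u \<in> Units A"
    using c_pre x u x_eq by (rule precartesian_unique_up_to_unit)
  then have "u \<in> Units M"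
    by (auto simp: Units_def kernel_monoid_simps intro: kernel_closed)
  then show ?thesis
    unfolding x_eq by (intro cartesian_mult c cartesian_unit)
qed

end

section \<open>The action determined by a cleavage\<close>

locale monoid_cleavage = monoid_morphism +
  fixes \<kappa>
  assumes cleavage: "cleavage M N \<sigma> \<kappa>"
begin

lemma \<kappa>_closed: "n \<in> carrier N \<Longrightarrow> \<kappa> n \<in> carrier M"
  using cleavage by (auto simp: cleavage_def)

lemma \<kappa>_one: "\<kappa> \<one>\<^bsub>N\<^esub> = \<one>\<^bsub>M\<^esub>"
  using cleavage by (simp add: cleavage_def)

lemma \<kappa>_precartesian: "n \<in> carrier N \<Longrightarrow> precartesian M N \<sigma> (\<kappa> n)"
  using cleavage by (simp add: cleavage_def)

lemma map_\<kappa>: "n \<in> carrier N \<Longrightarrow> \<sigma> (\<kappa> n) = n"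
  using cleavage by (simp add: cleavage_def)

lemma ex1_factor:
  assumes "n \<in> carrier N" "z \<in> carrier M" "\<sigma> z = n"
  shows "\<exists>!a. a \<in> K \<and> z = \<kappa> n \<otimes>\<^bsub>M\<^esub> a"
  using \<kappa>_precartesian[OF assms(1)] assms by (simp add: precartesian_def map_\<kappa>)

lemma \<kappa>_cancel:
  "\<lbrakk>n \<in> carrier N; \<kappa> n \<otimes>\<^bsub>M\<^esub> a = \<kappa> n \<otimes>\<^bsub>M\<^esub> b; a \<in> K; b \<in> K\<rbrakk> \<Longrightarrow> a = b"
  using precartesian_cancel \<kappa>_precartesian by blast

lemma lax_action_of_cleavage:
  assumes det: "determined_by_cleavage M N \<sigma> \<kappa> \<phi> \<gamma>"
  shows "lax_action N A \<phi> \<gamma>"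
proof -
  have \<phi>: "\<phi> n a \<in> K" and \<kappa>\<phi>: "\<kappa> n \<otimes>\<^bsub>M\<^esub> \<phi> n a = a \<otimes>\<^bsub>M\<^esub> \<kappa> n"
    if "a \<in> K" "n \<in> carrier N" for a n
    using det that by (simp_all add: determined_by_cleavage_def)
  have \<gamma>: "\<gamma> m n \<in> K" and \<kappa>\<gamma>: "\<kappa> (m \<otimes>\<^bsub>N\<^esub> n) \<otimes>\<^bsub>M\<^esub> \<gamma> m n = \<kappa> m \<otimes>\<^bsub>M\<^esub> \<kappa> n"
    if "m \<in> carrier N" "n \<in> carrier N" for m n
    using det that by (simp_all add: determined_by_cleavage_def)
  note closed = \<phi> \<gamma> \<kappa>_closed kernel_closed kernel_mult kernel_one
  \<comment> \<open>The defining equations, applied inside a longer product.\<close>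
  have \<kappa>\<phi>': "\<kappa> n \<otimes>\<^bsub>M\<^esub> (\<phi> n a \<otimes>\<^bsub>M\<^esub> x) = a \<otimes>\<^bsub>M\<^esub> (\<kappa> n \<otimes>\<^bsub>M\<^esub> x)"
    if "a \<in> K" "n \<in> carrier N" "x \<in> carrier M" for a n x
    using that by (simp add: closed \<kappa>\<phi> flip: M.m_assoc)
  have \<kappa>\<gamma>': "\<kappa> (m \<otimes>\<^bsub>N\<^esub> n) \<otimes>\<^bsub>M\<^esub> (\<gamma> m n \<otimes>\<^bsub>M\<^esub> x) = \<kappa> m \<otimes>\<^bsub>M\<^esub> (\<kappa> n \<otimes>\<^bsub>M\<^esub> x)"
    if "m \<in> carrier N" "n \<in> carrier N" "x \<in> carrier M" for m n x
    using that by (simp add: closed \<kappa>\<gamma> flip: M.m_assoc)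
  show ?thesis
    unfolding lax_action_def kernel_monoid_simps
  proof (intro conjI ballI)
    show "monoid N" by (rule N.monoid_axioms)
    show "monoid A" by (rule monoid_kernel)
    show "\<phi> \<in> carrier N \<rightarrow> K \<rightarrow> K" "\<gamma> \<in> carrier N \<rightarrow> carrier N \<rightarrow> K"
      using \<phi> \<gamma> by auto
  next
    fix a assume a: "a \<in> K"
    then show "\<phi> \<one>\<^bsub>N\<^esub> a = a"
      using \<kappa>\<phi>[of a "\<one>\<^bsub>N\<^esub>"] by (simp add: \<kappa>_one closed)
  next
    fix a m n assume a: "a \<in> K" and m: "m \<in> carrier N" and n: "n \<in> carrier N"
    let ?mn = "m \<otimes>\<^bsub>N\<^esub> n"
    have "\<kappa> ?mn \<otimes>\<^bsub>M\<^esub> (\<gamma> m n \<otimes>\<^bsub>M\<^esub> \<phi> n (\<phi> m a)) = a \<otimes>\<^bsub>M\<^esub> (\<kappa> m \<otimes>\<^bsub>M\<^esub> \<kappa> n)"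
      using a m n by (simp add: \<kappa>\<gamma>' \<kappa>\<phi> \<kappa>\<phi>' closed)
    also have "\<dots> = \<kappa> ?mn \<otimes>\<^bsub>M\<^esub> (\<phi> ?mn a \<otimes>\<^bsub>M\<^esub> \<gamma> m n)"
      using a m n by (simp add: \<kappa>\<phi>' \<kappa>\<gamma> closed)
    finally show "\<gamma> m n \<otimes>\<^bsub>M\<^esub> \<phi> n (\<phi> m a) = \<phi> ?mn a \<otimes>\<^bsub>M\<^esub> \<gamma> m n"
      by (rule \<kappa>_cancel[rotated]) (use a m n in \<open>simp_all add: closed\<close>)
  next
    fix m n k assume m: "m \<in> carrier N" and n: "n \<in> carrier N" and k: "k \<in> carrier N"
    let ?mn = "m \<otimes>\<^bsub>N\<^esub> n" and ?nk = "n \<otimes>\<^bsub>N\<^esub> k"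
    have "\<kappa> (?mn \<otimes>\<^bsub>N\<^esub> k) \<otimes>\<^bsub>M\<^esub> (\<gamma> ?mn k \<otimes>\<^bsub>M\<^esub> \<phi> k (\<gamma> m n)) = \<kappa> m \<otimes>\<^bsub>M\<^esub> (\<kappa> n \<otimes>\<^bsub>M\<^esub> \<kappa> k)"
      using m n k by (simp add: \<kappa>\<gamma>' \<kappa>\<phi> closed)
    also have "\<dots> = \<kappa> (m \<otimes>\<^bsub>N\<^esub> ?nk) \<otimes>\<^bsub>M\<^esub> (\<gamma> m ?nk \<otimes>\<^bsub>M\<^esub> \<gamma> n k)"
      using m n k by (simp add: \<kappa>\<gamma>' \<kappa>\<gamma> closed)
    also have "m \<otimes>\<^bsub>N\<^esub> ?nk = ?mn \<otimes>\<^bsub>N\<^esub> k"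
      using m n k by (simp add: N.m_assoc)
    finally show "\<gamma> ?mn k \<otimes>\<^bsub>M\<^esub> \<phi> k (\<gamma> m n) = \<gamma> m ?nk \<otimes>\<^bsub>M\<^esub> \<gamma> n k"
      by (rule \<kappa>_cancel[rotated]) (use m n k in \<open>simp_all add: closed\<close>)
  next
    fix m assume m: "m \<in> carrier N"
    show "\<gamma> \<one>\<^bsub>N\<^esub> m = \<one>\<^bsub>M\<^esub>"
      by (rule \<kappa>_cancel[OF m]) (use m \<kappa>\<gamma>[of "\<one>\<^bsub>N\<^esub>" m] in \<open>simp_all add: closed \<kappa>_one\<close>)
    show "\<gamma> m \<one>\<^bsub>N\<^esub> = \<one>\<^bsub>M\<^esub>"
      by (rule \<kappa>_cancel[OF m]) (use m \<kappa>\<gamma>[of m "\<one>\<^bsub>N\<^esub>"] in \<open>simp_all add: closed \<kappa>_one\<close>)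
    show "\<phi> m \<one>\<^bsub>M\<^esub> = \<one>\<^bsub>M\<^esub>"
      by (rule \<kappa>_cancel[OF m]) (use m in \<open>simp_all add: closed \<kappa>\<phi>\<close>)
  next
    fix m a b assume m: "m \<in> carrier N" and a: "a \<in> K" and b: "b \<in> K"
    show "\<phi> m (a \<otimes>\<^bsub>M\<^esub> b) = \<phi> m a \<otimes>\<^bsub>M\<^esub> \<phi> m b"
      by (rule \<kappa>_cancel[OF m]) (use m a b in \<open>simp_all add: closed \<kappa>\<phi> \<kappa>\<phi>' M.m_assoc\<close>)
  qed
qed

lemma pseudo_action_of_cleavage:
  assumes det: "determined_by_cleavage M N \<sigma> \<kappa> \<phi> \<gamma>" and fib: "fibration M N \<sigma>"
  shows "pseudo_action N A \<phi> \<gamma>"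
  unfolding pseudo_action_def
proof (intro conjI ballI)
  show "lax_action N A \<phi> \<gamma>"
    using det by (rule lax_action_of_cleavage)
next
  fix m n assume m: "m \<in> carrier N" and n: "n \<in> carrier N"
  have "precartesian M N \<sigma> (\<kappa> m \<otimes>\<^bsub>M\<^esub> \<kappa> n)"
    using m n
    by (intro cartesian_imp_precartesian[OF cartesian_mult]
        fibration_precartesian_imp_cartesian[OF fib] \<kappa>_precartesian)
  with \<kappa>_precartesian[OF N.m_closed[OF m n]] show "\<gamma> m n \<in> Units A"
    by (rule precartesian_unique_up_to_unit)
       (use det m n in \<open>simp_all add: determined_by_cleavage_def\<close>)
qed

end

theorem proposition5p3:
  fixes M :: "('a, 'x) monoid_scheme"
    and N :: "('b, 'y) monoid_scheme"
    and \<sigma> :: "'a \<Rightarrow> 'b"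
    and \<kappa> :: "'b \<Rightarrow> 'a"
  assumes "prefibration M N \<sigma>"
    and "cleavage M N \<sigma> \<kappa>"
  shows "(\<forall>a \<in> kernel M N \<sigma>. \<forall>n \<in> carrier N.
            \<exists>!b. b \<in> kernel M N \<sigma> \<and> a \<otimes>\<^bsub>M\<^esub> \<kappa> n = \<kappa> n \<otimes>\<^bsub>M\<^esub> b) \<and>
         (\<forall>m \<in> carrier N. \<forall>n \<in> carrier N.
            \<exists>!c. c \<in> kernel M N \<sigma> \<and> \<kappa> m \<otimes>\<^bsub>M\<^esub> \<kappa> n = \<kappa> (m \<otimes>\<^bsub>N\<^esub> n) \<otimes>\<^bsub>M\<^esub> c) \<and>
         (\<forall>\<phi> \<gamma>. determined_by_cleavage M N \<sigma> \<kappa> \<phi> \<gamma> \<longrightarrow>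
            lax_action N (kernel_monoid M N \<sigma>) \<phi> \<gamma> \<and>
            (fibration M N \<sigma> \<longrightarrow> pseudo_action N (kernel_monoid M N \<sigma>) \<phi> \<gamma>))"
proof -
  interpret monoid_cleavage M N \<sigma> \<kappa>
    using assms
    by (simp add: monoid_cleavage_def monoid_cleavage_axioms_def monoid_morphism_def
        monoid_morphism_axioms_def prefibration_def monoid_homomorphism_def)
  show ?thesis
  proof (intro conjI ballI allI impI)
    fix a n assume "a \<in> kernel M N \<sigma>" "n \<in> carrier N"
    then show "\<exists>!b. b \<in> kernel M N \<sigma> \<and> a \<otimes>\<^bsub>M\<^esub> \<kappa> n = \<kappa> n \<otimes>\<^bsub>M\<^esub> b"
      by (intro ex1_factor) (simp_all add: kernel_closed kernel_map \<kappa>_closed map_mult map_\<kappa>)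
  next
    fix m n assume "m \<in> carrier N" "n \<in> carrier N"
    then show "\<exists>!c. c \<in> kernel M N \<sigma> \<and> \<kappa> m \<otimes>\<^bsub>M\<^esub> \<kappa> n = \<kappa> (m \<otimes>\<^bsub>N\<^esub> n) \<otimes>\<^bsub>M\<^esub> c"
      by (intro ex1_factor) (simp_all add: \<kappa>_closed map_mult map_\<kappa>)
  qed (rule lax_action_of_cleavage pseudo_action_of_cleavage; assumption)+
qed

end
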